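(* Let $W$ be an $r \times c$ storage area with $r \le c$ whose open side is its bottom (front) row. In the online setting with lookahead $1$, any number $n \le rc$ of loads (i.e. full capacity or less), with any arrival sequence $A$ and departure sequence $D=(1,\dots,n)$, can always be stored in the order $A$ and subsequently retrieved in the order $D$ with at most $r-1$ relocations in total, using one action for each storage and at most two actions for each retrieval.
   Context: Storage area: a rectangular grid $W$ with $r$ rows and $c$ columns; the bottom row (front row) is the only side through which loads enter and leave. There are $n \le rc$ loads with distinct labels $1,\dots,n$, each occupying exactly one cell; no two loads share a cell. A load moves only along paths of horizontally/vertically adjacent cells (moves up, down, left, right) that are currently empty (apart from the load's own starting cell). Actions: (Storage) an arriving load is placed in an empty cell $v$ via a path from any cell of the front row to $v$. (Retrieval) a load is removed via a path from its current cell to any cell of the front row. (Relocation) a load is moved inside $W$ from its current cell to an empty cell $v$ via a path, where $v$ and the original cell must be accessible from the front row. Loads arrive one at a time in the order $A=(a_1,\dots,a_n)$ (a permutation of $\{1,\dots,n\}$), each being stored before the next arrives; after all are stored, they are retrieved in the order of the departure sequence $D$, fixed to be $(1,\dots,n)$ by relabeling. The number of actions for a retrieval counts the retrieval action of the departing load together with the relocations performed in order to retrieve it (i.e. since the previous retrieval); likewise for storage. Online setting with lookahead $\ell$: when a load $a_t$ is to be stored, only the next $\ell$ arriving loads $a_t,\dots,a_{t+\ell-1}$ (as far as they exist) are known, besides the past arrivals; the departure sequence $D$ is fully known (so $n$ and the position of each known load in $D$ are known). With lookahead $1$, only the load $a_t$ currently being stored is known. *)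

theory Defs
  imports Main
begin

text \<open>
  Cells are pairs (row, column), rows \<open>1..r\<close> counted from the front, columns \<open>1..c\<close>.
  A configuration maps a cell to the label of the load it holds, if any.
\<close>

type_synonym cell = "nat \<times> nat"
type_synonym config = "cell \<Rightarrow> nat option"

definition grid :: "nat \<Rightarrow> nat \<Rightarrow> cell set" where
  "grid r c = {1..r} \<times> {1..c}"

definition front_row :: "nat \<Rightarrow> nat \<Rightarrow> cell set" where
  "front_row r c = {v \<in> grid r c. fst v = 1}"

definition adjacent :: "cell \<Rightarrow> cell \<Rightarrow> bool" where
  "adjacent u v \<longleftrightarrow>
     (fst u = fst v \<and> (snd v = snd u + 1 \<or> snd u = snd v + 1)) \<or>
     (snd u = snd v \<and> (fst v = fst u + 1 \<or> fst u = fst v + 1))"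

definition empty_cells :: "nat \<Rightarrow> nat \<Rightarrow> config \<Rightarrow> cell set" where
  "empty_cells r c s = {v \<in> grid r c. s v = None}"

definition path_within :: "cell set \<Rightarrow> cell \<Rightarrow> cell \<Rightarrow> bool" where
  "path_within F u v \<longleftrightarrow>
     (\<exists>p. p \<noteq> [] \<and> hd p = u \<and> last p = v \<and> set p \<subseteq> F \<and> successively adjacent p)"

text \<open>
  Every cell of the path except possibly \<open>v\<close> itself is empty, so occupied cells can be accessible.
\<close>

definition accessible :: "nat \<Rightarrow> nat \<Rightarrow> config \<Rightarrow> cell \<Rightarrow> bool" where
  "accessible r c s v \<longleftrightarrow>
     (\<exists>f \<in> front_row r c. path_within (insert v (empty_cells r c s)) f v)"

text \<open>
  \<open>Store x v\<close> puts the arriving load \<open>x\<close> into \<open>v\<close>, \<open>Retrieve x u\<close> removes \<open>x\<close> from \<open>u\<close>,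
  and \<open>Relocate x u v\<close> moves \<open>x\<close> from \<open>u\<close> to \<open>v\<close>.
  Accessibility of the target of a relocation refers to the configuration before the move, in which
  \<open>u\<close> is still occupied.
\<close>

datatype action = Store nat cell | Retrieve nat cell | Relocate nat cell cell

fun legal :: "nat \<Rightarrow> nat \<Rightarrow> config \<Rightarrow> action \<Rightarrow> bool" where
  "legal r c s (Store x v) \<longleftrightarrow>
     x \<notin> ran s \<and> v \<in> empty_cells r c s \<and>
     (\<exists>f \<in> front_row r c. path_within (empty_cells r c s) f v)"
| "legal r c s (Retrieve x u) \<longleftrightarrow>
     u \<in> grid r c \<and> s u = Some x \<and>
     (\<exists>f \<in> front_row r c. path_within (insert u (empty_cells r c s)) u f)"
| "legal r c s (Relocate x u v) \<longleftrightarrow>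
     u \<in> grid r c \<and> s u = Some x \<and> v \<in> empty_cells r c s \<and>
     accessible r c s u \<and> accessible r c s v \<and>
     path_within (insert u (empty_cells r c s)) u v"

fun effect :: "config \<Rightarrow> action \<Rightarrow> config" where
  "effect s (Store x v) = s(v := Some x)"
| "effect s (Retrieve x u) = s(u := None)"
| "effect s (Relocate x u v) = s(u := None, v := Some x)"

fun legal_run :: "nat \<Rightarrow> nat \<Rightarrow> config \<Rightarrow> action list \<Rightarrow> bool" where
  "legal_run r c s [] \<longleftrightarrow> True"
| "legal_run r c s (a # as) \<longleftrightarrow> legal r c s a \<and> legal_run r c (effect s a) as"

fun is_relocation :: "action \<Rightarrow> bool" where
  "is_relocation (Relocate x u v) \<longleftrightarrow> True"
| "is_relocation (Store x v) \<longleftrightarrow> False"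
| "is_relocation (Retrieve x u) \<longleftrightarrow> False"

definition num_relocations :: "action list \<Rightarrow> nat" where
  "num_relocations as = length (filter is_relocation as)"

text \<open>
  The actions charged to a load in a phase: relocations made on its behalf, and finally its own
  storage or retrieval.
\<close>

definition storage_block :: "nat \<Rightarrow> action list \<Rightarrow> bool" where
  "storage_block x b \<longleftrightarrow> (\<exists>rel v. b = rel @ [Store x v] \<and> list_all is_relocation rel)"

definition retrieval_block :: "nat \<Rightarrow> action list \<Rightarrow> bool" where
  "retrieval_block x b \<longleftrightarrow> (\<exists>rel u. b = rel @ [Retrieve x u] \<and> list_all is_relocation rel)"

definition arrival_sequence :: "nat \<Rightarrow> nat list \<Rightarrow> bool" where
  "arrival_sequence n A \<longleftrightarrow> distinct A \<and> set A = {1..n}"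

text \<open>
  Storage and retrieval blocks for all loads, starting from an empty storage area: loads are stored
  in the order \<open>A\<close> and then retrieved in the order \<open>1,\<dots>,n\<close>.
\<close>

definition valid_plan ::
  "nat \<Rightarrow> nat \<Rightarrow> nat \<Rightarrow> nat list \<Rightarrow> action list list \<Rightarrow> action list list \<Rightarrow> bool" where
  "valid_plan r c n A Ss Rs \<longleftrightarrow>
     list_all2 storage_block A Ss \<and>
     list_all2 retrieval_block [1..<n + 1] Rs \<and>
     legal_run r c Map.empty (concat Ss @ concat Rs)"

text \<open>
  An online storage policy \<open>\<sigma>\<close> (for fixed \<open>r\<close>, \<open>c\<close>, \<open>n\<close>) yields the actions performed to store
  the load at the zero-based position \<open>t\<close> of the arrival sequence. With lookahead \<open>l\<close> it sees only
  the \<open>t\<close> past arrivals and the next \<open>l\<close> ones, i.e. the first \<open>t + l\<close> entries of \<open>A\<close>.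
\<close>

type_synonym policy = "nat \<Rightarrow> nat list \<Rightarrow> action list"

definition online_storage :: "nat \<Rightarrow> policy \<Rightarrow> nat list \<Rightarrow> action list list" where
  "online_storage l \<sigma> A = map (\<lambda>t. \<sigma> t (take (t + l) A)) [0..<length A]"

end

theory Submission
  imports Defs
begin

text \<open>
  Once column \<open>q\<close> is empty, every load of column \<open>q + 1\<close> is accessible. So each column \<open>q \<ge> 4\<close> simply
  stacks up the \<open>r\<close> labels \<open>(q - 1) r + 1, \<dots>, q r\<close>, and it remains to open a first column among the
  first three, which hold the labels \<open>1, \<dots>, 3 r\<close>. The place of load \<open>k \<le> r\<close> is row \<open>k\<close> of column 2.
  Every other load of the first three columns is kept in a row smaller than its label. When load \<open>k\<close>
  is due, rows \<open>1, \<dots>, k - 1\<close> of column 2 are empty, so \<open>k\<close> is accessible: it is either at its place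
  or beside this free stretch. In the latter case, one relocation moves the load that occupies its
  place into the cell vacated by \<open>k\<close>; this never happens for \<open>k = 1\<close>. Areas with fewer than three
  columns have one row or are \<open>2 \<times> 2\<close>.
\<close>

section \<open>Paths and accessible cells\<close>

lemma adjacent_sym: "adjacent u v \<longleftrightarrow> adjacent v u"
  by (auto simp: adjacent_def)

lemma path_within_refl: "u \<in> F \<Longrightarrow> path_within F u u"
  unfolding path_within_def by (intro exI[of _ "[u]"]) auto

lemma path_within_snoc:
  assumes "path_within F u v" "adjacent v w" "w \<in> F"
  shows "path_within F u w"
proof -
  from assms(1) obtain p where "p \<noteq> []" "hd p = u" "last p = v" "set p \<subseteq> F" "successively adjacent p"
    unfolding path_within_def by blast
  then show ?thesis
    using assms unfolding path_within_def
    by (intro exI[of _ "p @ [w]"]) (auto simp: successively_append_iff)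
qed

lemma path_within_sym:
  assumes "path_within F u v"
  shows "path_within F v u"
proof -
  from assms obtain p where "p \<noteq> []" "hd p = u" "last p = v" "set p \<subseteq> F" "successively adjacent p"
    unfolding path_within_def by blast
  moreover from \<open>successively adjacent p\<close> have "successively (\<lambda>x y. adjacent y x) p"
    by (rule successively_mono) (simp add: adjacent_sym)
  ultimately show ?thesis
    unfolding path_within_def
    by (intro exI[of _ "rev p"]) (auto simp: hd_rev last_rev)
qed

lemma path_within_column:
  assumes "a \<le> b" "\<And>i. a \<le> i \<Longrightarrow> i \<le> b \<Longrightarrow> (i, q) \<in> F"
  shows "path_within F (a, q) (b, q)"
  using assms
proof (induction b rule: dec_induct)
  case base
  then show ?case by (simp add: path_within_refl)
next
  case (step b)
  have 1: "path_within F (a, q) (b, q)"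
    by (rule step.IH) (simp add: step.prems)
  have 2: "(Suc b, q) \<in> F"
    using step by simp
  show ?case
    by (rule path_within_snoc[OF 1 _ 2]) (simp add: adjacent_def)
qed

text \<open>The path climbs column \<open>q\<close> from the front. Only the cells in front of
  \<open>(j, q)\<close> must be empty, so the lemma serves targets of storage as well as
  loads.\<close>

lemma accessible_column:
  assumes "(j, q) \<in> grid r c" "\<And>i. 1 \<le> i \<Longrightarrow> i < j \<Longrightarrow> s (i, q) = None"
  shows "accessible r c s (j, q)"
  unfolding accessible_def
proof
  show "(1, q) \<in> front_row r c"
    using assms(1) by (auto simp: front_row_def grid_def)
  show "path_within (insert (j, q) (empty_cells r c s)) (1, q) (j, q)"
    using assms by (intro path_within_column) (auto simp: grid_def empty_cells_def le_less)
qed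

text \<open>The path climbs the free column \<open>p\<close> to row \<open>j\<close> and ends with
  one sideways step. This reaches cells that are blocked within their own column.\<close>

lemma accessible_beside_column:
  assumes "(j, q) \<in> grid r c" "(j, p) \<in> grid r c" "p = Suc q \<or> q = Suc p"
    and "\<And>i. 1 \<le> i \<Longrightarrow> i \<le> j \<Longrightarrow> s (i, p) = None"
  shows "accessible r c s (j, q)"
  unfolding accessible_def
proof
  show "(1, p) \<in> front_row r c"
    using assms(2) by (auto simp: front_row_def grid_def)
  show "path_within (insert (j, q) (empty_cells r c s)) (1, p) (j, q)"
    using assms
    by (intro path_within_snoc[OF path_within_column[of 1 j p]])
      (auto simp: grid_def empty_cells_def adjacent_def)
qed

lemma legal_StoreI:
  assumes "x \<notin> ran s" "v \<in> grid r c" "s v = None" "accessible r c s v"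
  shows "legal r c s (Store x v)"
proof -
  have "insert v (empty_cells r c s) = empty_cells r c s"
    using assms by (auto simp: empty_cells_def)
  then show ?thesis
    using assms by (auto simp: accessible_def empty_cells_def)
qed

lemma legal_RetrieveI:
  assumes "u \<in> grid r c" "s u = Some x" "accessible r c s u"
  shows "legal r c s (Retrieve x u)"
proof -
  from assms(3) obtain f where f: "f \<in> front_row r c"
    "path_within (insert u (empty_cells r c s)) f u"
    unfolding accessible_def by blast
  from path_within_sym[OF f(2)] f(1) assms show ?thesis by auto
qed

lemma legal_run_append:
  "legal_run r c s (as @ bs) \<longleftrightarrow> legal_run r c s as \<and> legal_run r c (foldl effect s as) bs"
  by (induction as arbitrary: s) auto

lemma ran_remove:
  assumes "s u = Some x" "\<And>v. s v = Some x \<Longrightarrow> v = u"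
  shows "ran (s(u := None)) = ran s - {x}"
proof -
  have "y \<in> ran (s(u := None)) \<longleftrightarrow> y \<in> ran s \<and> y \<noteq> x" for y
    unfolding ran_def mem_Collect_eq fun_upd_apply
    using assms by (metis option.distinct(1) option.inject)
  then show ?thesis by blast
qed

section \<open>Storage policies from invariants\<close>

text \<open>The invariant \<open>I\<close> alone guides the choice. That a suitable cell exists is
  left to the users of the definition.\<close>

definition chosen_cell :: "nat \<Rightarrow> nat \<Rightarrow> (config \<Rightarrow> bool) \<Rightarrow> config \<Rightarrow> nat \<Rightarrow> cell" where
  "chosen_cell r c I s x = (SOME v. legal r c s (Store x v) \<and> I (s(v := Some x)))"

definition layout :: "nat \<Rightarrow> nat \<Rightarrow> (config \<Rightarrow> bool) \<Rightarrow> nat list \<Rightarrow> config" where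
  "layout r c I = foldl (\<lambda>s x. s(chosen_cell r c I s x := Some x)) Map.empty"

text \<open>With lookahead 1 the visible list \<open>xs\<close> consists of the past arrivals
  followed by the current load, hence \<open>butlast\<close> and \<open>last\<close>. The current
  configuration is recomputed from the past arrivals.\<close>

definition invariant_policy :: "nat \<Rightarrow> nat \<Rightarrow> (config \<Rightarrow> bool) \<Rightarrow> policy" where
  "invariant_policy r c I t xs =
    [Store (last xs) (chosen_cell r c I (layout r c I (butlast xs)) (last xs))]"

lemma online_storage_invariant_policy_snoc:
  "online_storage 1 (invariant_policy r c I) (xs @ [x]) =
    online_storage 1 (invariant_policy r c I) xs @ [[Store x (chosen_cell r c I (layout r c I xs) x)]]"
  by (auto simp: online_storage_def invariant_policy_def)

text \<open>Induction over the arrived prefix works because a further arrival leaves all earlier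
  blocks unchanged.\<close>

lemma invariant_policy_run:
  assumes "I Map.empty"
    and step: "\<And>s x. I s \<Longrightarrow> x \<in> {1..n} \<Longrightarrow> x \<notin> ran s \<Longrightarrow>
      \<exists>v. legal r c s (Store x v) \<and> I (s(v := Some x))"
    and "distinct xs" "set xs \<subseteq> {1..n}"
  defines "Ss \<equiv> online_storage 1 (invariant_policy r c I) xs"
  shows "I (layout r c I xs) \<and> ran (layout r c I xs) = set xs \<and>
    legal_run r c Map.empty (concat Ss) \<and> foldl effect Map.empty (concat Ss) = layout r c I xs \<and>
    list_all2 storage_block xs Ss \<and> (\<forall>b \<in> set Ss. length b = 1) \<and> num_relocations (concat Ss) = 0"
  using assms(3,4) unfolding Ss_def
proof (induction xs rule: rev_induct)
  case Nil
  then show ?case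
    using assms(1) by (simp add: layout_def online_storage_def num_relocations_def)
next
  case (snoc x xs)
  let ?s = "layout r c I xs"
  let ?v = "chosen_cell r c I ?s x"
  have IH: "I ?s" "ran ?s = set xs"
    using snoc by auto
  then have "\<exists>v. legal r c ?s (Store x v) \<and> I (?s(v := Some x))"
    using snoc.prems by (intro step) auto
  then have v: "legal r c ?s (Store x ?v)" "I (?s(?v := Some x))"
    unfolding chosen_cell_def by (metis (mono_tags, lifting) someI_ex)+
  then have "?s ?v = None"
    by (simp add: empty_cells_def)
  moreover have "layout r c I (xs @ [x]) = ?s(?v := Some x)"
    by (simp add: layout_def)
  moreover have "storage_block x [Store x ?v]"
    by (simp add: storage_block_def)
  ultimately show ?case
    using v snoc IH
    by (auto simp: online_storage_invariant_policy_snoc legal_run_append num_relocations_def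
        intro!: list_all2_appendI simp del: legal.simps fun_upd_apply One_nat_def)
qed

section \<open>Retrieval plans\<close>

text \<open>Describes the task that remains from load \<open>k\<close> on, so that plans can be
  built load by load with a budget \<open>m\<close> of relocations.\<close>

definition retrieval_plan :: "nat \<Rightarrow> nat \<Rightarrow> nat \<Rightarrow> nat \<Rightarrow> config \<Rightarrow> nat \<Rightarrow> bool" where
  "retrieval_plan r c n k s m \<longleftrightarrow>
    (\<exists>Rs. list_all2 retrieval_block [k..<n + 1] Rs \<and> legal_run r c s (concat Rs) \<and>
      (\<forall>b \<in> set Rs. length b \<le> 2) \<and> num_relocations (concat Rs) \<le> m)"

lemma retrieval_plan_done: "n < k \<Longrightarrow> retrieval_plan r c n k s m"
  unfolding retrieval_plan_def by (intro exI[of _ "[]"]) (auto simp: num_relocations_def)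

lemma retrieval_plan_mono: "retrieval_plan r c n k s m \<Longrightarrow> m \<le> m' \<Longrightarrow> retrieval_plan r c n k s m'"
  unfolding retrieval_plan_def by (meson le_trans)

lemma retrieval_plan_retrieve:
  assumes "k \<le> n" "legal r c s (Retrieve k u)" "retrieval_plan r c n (Suc k) (s(u := None)) m"
  shows "retrieval_plan r c n k s m"
proof -
  from assms(3) obtain Rs where "list_all2 retrieval_block [Suc k..<n + 1] Rs"
    "legal_run r c (s(u := None)) (concat Rs)" "\<forall>b \<in> set Rs. length b \<le> 2"
    "num_relocations (concat Rs) \<le> m"
    unfolding retrieval_plan_def by blast
  then show ?thesis
    using assms(1,2) unfolding retrieval_plan_def
    by (intro exI[of _ "[Retrieve k u] # Rs"])
      (auto simp: upt_conv_Cons num_relocations_def retrieval_block_def simp del: upt_Suc legal.simps)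
qed

lemma retrieval_plan_relocate:
  assumes "k \<le> n" "legal r c s (Relocate x u v)" "s' = s(u := None, v := Some x)"
    and "legal r c s' (Retrieve k w)" "retrieval_plan r c n (Suc k) (s'(w := None)) m"
  shows "retrieval_plan r c n k s (Suc m)"
proof -
  from assms(5) obtain Rs where "list_all2 retrieval_block [Suc k..<n + 1] Rs"
    "legal_run r c (s'(w := None)) (concat Rs)" "\<forall>b \<in> set Rs. length b \<le> 2"
    "num_relocations (concat Rs) \<le> m"
    unfolding retrieval_plan_def by blast
  then show ?thesis
    using assms(1-4) unfolding retrieval_plan_def
    by (intro exI[of _ "[Relocate x u v, Retrieve k w] # Rs"])
      (auto simp: upt_conv_Cons num_relocations_def retrieval_block_def simp del: upt_Suc legal.simps)
qed

text \<open>The property \<open>P\<close> makes every stored load retrievable at once and survives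
  the removal of any load, so no relocation is ever required. The induction runs on the number
  \<open>d\<close> of remaining loads.\<close>

lemma retrieval_plan_direct:
  assumes "Suc n - k = d" "ran s = {k..n}" "P s"
    and inj: "\<And>s u v x. P s \<Longrightarrow> s u = Some x \<Longrightarrow> s v = Some x \<Longrightarrow> u = v"
    and step: "\<And>s u x. P s \<Longrightarrow> s u = Some x \<Longrightarrow> legal r c s (Retrieve x u) \<and> P (s(u := None))"
  shows "retrieval_plan r c n k s 0"
  using assms(1-3)
proof (induction d arbitrary: k s)
  case 0
  then show ?case by (simp add: retrieval_plan_done)
next
  case (Suc d)
  then have k: "k \<le> n" by simp
  with Suc.prems have "k \<in> ran s" by simp
  then obtain u where u: "s u = Some k" by (auto simp: ran_def)
  have "ran (s(u := None)) = {k..n} - {k}"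
    using ran_remove[of s, OF u] inj[OF Suc.prems(3) _ u] Suc.prems(2) by metis
  also have "\<dots> = {Suc k..n}" by auto
  finally have "ran (s(u := None)) = {Suc k..n}" .
  moreover have "Suc n - Suc k = d"
    using Suc.prems(1) by simp
  ultimately have "retrieval_plan r c n (Suc k) (s(u := None)) 0"
    using step[OF Suc.prems(3) u] by (intro Suc.IH) blast+
  then show ?case
    using step[OF Suc.prems(3) u] by (intro retrieval_plan_retrieve[OF k]) blast+
qed

text \<open>Reduces the problem to an invariant that admits every storage and permits cheap
  retrieval. The policy is fixed before \<open>A\<close>, whereas the retrieval plan may depend on
  the whole final configuration.\<close>

lemma invariant_policy_correct:
  assumes "I Map.empty"
    and "\<And>s x. I s \<Longrightarrow> x \<in> {1..n} \<Longrightarrow> x \<notin> ran s \<Longrightarrow>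
      \<exists>v. legal r c s (Store x v) \<and> I (s(v := Some x))"
    and retr: "\<And>s. I s \<Longrightarrow> ran s = {1..n} \<Longrightarrow> retrieval_plan r c n 1 s m"
  shows "\<exists>\<sigma> :: policy. \<forall>A. arrival_sequence n A \<longrightarrow>
    (\<exists>Rs. valid_plan r c n A (online_storage 1 \<sigma> A) Rs \<and>
          (\<forall>b \<in> set (online_storage 1 \<sigma> A). length b = 1) \<and>
          (\<forall>b \<in> set Rs. length b \<le> 2) \<and>
          num_relocations (concat (online_storage 1 \<sigma> A) @ concat Rs) \<le> m)"
proof (rule exI[of _ "invariant_policy r c I"], intro allI impI)
  fix A
  let ?s = "layout r c I A" and ?Ss = "online_storage 1 (invariant_policy r c I) A"
  assume "arrival_sequence n A"
  then have A: "distinct A" "set A = {1..n}"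
    by (auto simp: arrival_sequence_def)
  note run = invariant_policy_run[of I, OF assms(1,2) A(1) equalityD1[OF A(2)]]
  then have "retrieval_plan r c n 1 ?s m"
    using A retr by auto
  then obtain Rs where "list_all2 retrieval_block [1..<n + 1] Rs" "legal_run r c ?s (concat Rs)"
      "\<forall>b \<in> set Rs. length b \<le> 2" "num_relocations (concat Rs) \<le> m"
    unfolding retrieval_plan_def by blast
  with run show "\<exists>Rs. valid_plan r c n A ?Ss Rs \<and> (\<forall>b \<in> set ?Ss. length b = 1) \<and>
      (\<forall>b \<in> set Rs. length b \<le> 2) \<and> num_relocations (concat ?Ss @ concat Rs) \<le> m"
    unfolding valid_plan_def legal_run_append num_relocations_def filter_append length_append
    by (intro exI[of _ Rs] conjI) (simp_all del: One_nat_def upt_Suc)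
qed

section \<open>Three or more columns\<close>

text \<open>As rows start at 1, label 1 fits only at (1, 2). Labels from \<open>r + 1\<close> to
  \<open>3 * r\<close> fit anywhere in the first three columns.\<close>

definition slot :: "nat \<Rightarrow> nat \<Rightarrow> nat \<Rightarrow> nat \<Rightarrow> nat \<Rightarrow> bool" where
  "slot r c x j q \<longleftrightarrow> (j, q) \<in> grid r c \<and>
    (if q \<le> 3 then x \<le> 3 * r \<and> (j < x \<or> j = x \<and> q = 2) else (q - 1) * r < x \<and> x \<le> q * r)"

definition arranged :: "nat \<Rightarrow> nat \<Rightarrow> config \<Rightarrow> bool" where
  "arranged r c s \<longleftrightarrow> (\<forall>j q x. s (j, q) = Some x \<longrightarrow> slot r c x j q) \<and>
    (\<forall>u v x. s u = Some x \<longrightarrow> s v = Some x \<longrightarrow> u = v)"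

lemma arranged_slot: "arranged r c s \<Longrightarrow> s (j, q) = Some x \<Longrightarrow> slot r c x j q"
  by (simp add: arranged_def)

lemma arranged_inj: "arranged r c s \<Longrightarrow> s u = Some x \<Longrightarrow> s v = Some x \<Longrightarrow> u = v"
  unfolding arranged_def by blast

lemma arranged_store:
  assumes "arranged r c s" "slot r c x j q" "x \<notin> ran s"
  shows "arranged r c (s((j, q) := Some x))"
proof -
  have "s u \<noteq> Some x" for u
    using assms(3) by (meson ranI)
  then have "u = v" if "(s((j, q) := Some x)) u = Some y" "(s((j, q) := Some x)) v = Some y" for u v y
    using that arranged_inj[OF assms(1)] by (metis fun_upd_apply option.inject)
  moreover have "slot r c y i p" if "(s((j, q) := Some x)) (i, p) = Some y" for i p y
    using that assms(2) arranged_slot[OF assms(1)] by (auto split: if_splits)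
  ultimately show ?thesis
    unfolding arranged_def by blast
qed

lemma arranged_remove:
  assumes "arranged r c s"
  shows "arranged r c (s(u := None))"
proof -
  have "s v = Some x" if "(s(u := None)) v = Some x" for v x
    using that by (simp split: if_splits)
  then show ?thesis
    using assms unfolding arranged_def by blast
qed

text \<open>Distinct cells hold distinct labels, so the labels in \<open>F\<close> would be too many
  for \<open>T\<close> without \<open>x\<close>. This shows that there is still room for an absent
  load.\<close>

lemma arranged_pigeonhole:
  assumes "arranged r c s" "finite T" "x \<in> T" "x \<notin> ran s" "finite F" "card T \<le> card F"
    and "\<And>v. v \<in> F \<Longrightarrow> \<exists>y \<in> T. s v = Some y"
  shows False
proof -
  have "inj_on (\<lambda>v. the (s v)) F"
  proof (rule inj_onI)
    fix u v assume "u \<in> F" "v \<in> F" "the (s u) = the (s v)"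
    then show "u = v"
      using assms(7)[of u] assms(7)[of v] arranged_inj[OF assms(1)] by (metis option.sel)
  qed
  moreover have "(\<lambda>v. the (s v)) ` F \<subseteq> T - {x}"
  proof (rule image_subsetI)
    fix v assume "v \<in> F"
    with assms(7) obtain y where "y \<in> T" "s v = Some y" by blast
    then show "the (s v) \<in> T - {x}"
      using assms(4) by (auto dest: ranI)
  qed
  ultimately have "card F \<le> card (T - {x})"
    using assms(2) by (intro card_inj_on_le) auto
  also have "\<dots> < card T"
    using assms(2,3) by (rule card_Diff1_less)
  finally show False
    using assms(6) by simp
qed

text \<open>
  The free cells of a column \<open>q \<noteq> 2\<close> are its rows up to \<open>h q\<close>.
  Column 3 stays open as the corridor through which column 2 is filled, so (\<open>j\<close>, 3) is only filled
  after (\<open>j\<close>, 2), except in row 1, where (1, 2) is kept for load 1. If load \<open>x = h 3\<close> finds its place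
  (\<open>x\<close>, 2) taken, it goes to (\<open>x - 1\<close>, 1); this is why column 1 must not run ahead of column 3 by more
  than one row before load \<open>h 3\<close> is stored.
\<close>

definition stacked :: "nat \<Rightarrow> nat \<Rightarrow> config \<Rightarrow> (nat \<Rightarrow> nat) \<Rightarrow> bool" where
  "stacked r c s h \<longleftrightarrow>
    (\<forall>q j. q \<in> {1..c} - {2} \<longrightarrow> j \<in> {1..r} \<longrightarrow> (s (j, q) = None \<longleftrightarrow> j \<le> h q)) \<and>
    (\<forall>q. h q \<le> r) \<and> h 1 \<le> h 3 \<and> h 3 \<le> h 1 + 2 \<and>
    (2 \<le> h 3 \<longrightarrow> h 3 \<notin> ran s \<longrightarrow> h 3 \<le> h 1 + 1) \<and>
    (h 1 = h 3 \<longrightarrow> s (h 3, 2) \<in> {None, Some (h 3)}) \<and>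
    (\<forall>j \<in> {2..r}. h 3 < j \<longrightarrow> s (j, 2) \<noteq> None) \<and>
    (\<forall>j. j = 1 \<or> j < h 3 \<longrightarrow> s (j, 2) \<in> {None, Some j})"

lemma stacked_column:
  assumes "stacked r c s h" "1 \<le> q" "q \<le> c" "q \<noteq> 2" "1 \<le> j" "j \<le> r"
  shows "s (j, q) = None \<longleftrightarrow> j \<le> h q"
  using assms by (auto simp: stacked_def)

section \<open>Storage with at least three columns\<close>

lemma column_class:
  fixes r x :: nat
  assumes "0 < r" "3 * r < x" "x \<le> r * c"
  obtains q where "4 \<le> q" "q \<le> c" "(q - 1) * r < x" "x \<le> q * r"
proof
  \<comment> \<open>Subtracting 1 before the division keeps the multiple \<open>q * r\<close> in
    class \<open>q\<close>.\<close>
  let ?q = "(x - 1) div r + 1"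
  have "3 \<le> (x - 1) div r"
    using assms by (simp add: less_eq_div_iff_mult_less_eq)
  then show "4 \<le> ?q" by simp
  have "(x - 1) div r < c"
    using assms by (simp add: div_less_iff_less_mult mult.commute)
  then show "?q \<le> c" by simp
  have "(x - 1) div r * r \<le> x - 1"
    by (rule div_times_less_eq_dividend)
  then have "(x - 1) div r * r < x"
    using assms by linarith
  then show "(?q - 1) * r < x"
    by simp
  have "x - 1 < ((x - 1) div r + 1) * r"
    using assms(1) by (metis Suc_eq_plus1 dividend_less_div_times mult_Suc add.commute)
  then show "x \<le> ?q * r"
    by linarith
qed

text \<open>A load \<open>x \<le> 3 * r\<close> goes to its place while that is free and reachable.
  A load larger than \<open>h 3\<close> fills row \<open>h 3\<close> in the order column 1, column
  2, column 3, except that (1, 2) is skipped; closing column 3 shortens the corridor by one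
  row.\<close>

lemma arranged_store_step:
  assumes "arranged r c s" "stacked r c s h" "1 \<le> x" "x \<le> r * c" "x \<notin> ran s" "3 \<le> c"
  shows "\<exists>v. legal r c s (Store x v) \<and> arranged r c (s(v := Some x)) \<and>
    (\<exists>h'. stacked r c (s(v := Some x)) h')"
proof -
  have r: "0 < r"
    using assms by (cases r) auto
  have not_x: "s v \<noteq> Some x" for v
    using assms(5) by (auto dest: ranI)
  have legal_slot: "legal r c s (Store x (j, q)) \<and> arranged r c (s((j, q) := Some x))"
    if "slot r c x j q" "s (j, q) = None" "accessible r c s (j, q)" for j q
    using that assms legal_StoreI[of x s "(j, q)" r c] arranged_store[OF assms(1) that(1) assms(5)]
    by (simp add: slot_def del: legal.simps)
  have stack: "legal r c s (Store x (h q, q)) \<and> arranged r c (s((h q, q) := Some x))"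
    if "slot r c x (h q) q" "q \<noteq> 2" for q
  proof (rule legal_slot)
    have q: "(h q, q) \<in> grid r c" "1 \<le> q" "q \<le> c"
      using that by (auto simp: slot_def grid_def)
    then have empty: "s (i, q) = None" if "1 \<le> i" "i \<le> h q" for i
      using stacked_column[OF assms(2), of q i] that \<open>q \<noteq> 2\<close> by (auto simp: grid_def)
    then show "s (h q, q) = None"
      using q by (auto simp: grid_def)
    show "accessible r c s (h q, q)"
      using empty q by (intro accessible_column) auto
  qed (fact that)
  have h_le: "h q \<le> r" for q
    using assms(2) by (simp add: stacked_def)
  have h13: "h 1 \<le> h 3" "h 3 \<le> h 1 + 2"
    using assms(2) by (simp_all add: stacked_def)
  have gap: "h 3 \<le> h 1 + 1" if "2 \<le> h 3" "h 3 \<notin> ran s"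
    using assms(2) that by (simp add: stacked_def)
  have level: "s (h 3, 2) = None \<or> s (h 3, 2) = Some (h 3)" if "h 1 = h 3"
    using assms(2) that by (simp add: stacked_def)
  have behind: "s (j, 2) \<noteq> None" if "2 \<le> j" "j \<le> r" "h 3 < j" for j
    using assms(2) that by (simp add: stacked_def)
  have ahead: "s (j, 2) = None \<or> s (j, 2) = Some j" if "j = 1 \<or> j < h 3" for j
    using assms(2) that by (auto simp: stacked_def)
  have corridor: "s (i, 3) = None" if "1 \<le> i" "i \<le> h 3" for i
    using stacked_column[OF assms(2), of 3 i] that h_le[of 3] assms(6) by auto
  have h_upd_le: "(h(q := h q - 1)) p \<le> r" for p q
    using h_le[of p] by (cases "p = q") auto
  have columns: "(s((h q, q) := Some x)) (i, p) = None \<longleftrightarrow> i \<le> (h(q := h q - 1)) p"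
    if "p \<in> {1..c} - {2}" "i \<in> {1..r}" for q i p
    using stacked_column[OF assms(2), of p i] that by (cases "p = q") auto
  have columns_2: "(s((j, 2) := Some x)) (i, p) = None \<longleftrightarrow> i \<le> h p"
    if "p \<in> {1..c} - {2}" "i \<in> {1..r}" for j i p
    using stacked_column[OF assms(2), of p i] that by auto
  have ran: "ran s \<subseteq> ran (s(v := Some x))" "x \<in> ran (s(v := Some x))" if "s v = None" for v
    using that by auto
  show ?thesis
  proof (cases "3 * r < x")
    case True
    obtain q where q: "4 \<le> q" "q \<le> c" "(q - 1) * r < x" "x \<le> q * r"
      using column_class[OF r True assms(4)] .
    have "h q \<noteq> 0"
    proof
      assume "h q = 0"
      \<comment> \<open>Class \<open>q\<close> has just \<open>r\<close> labels, so a full column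
        \<open>q\<close> would already contain \<open>x\<close>.\<close>
      show False
      proof (rule arranged_pigeonhole[OF assms(1) _ _ assms(5)])
        show "x \<in> {(q - 1) * r<..q * r}" using q by simp
        show "card {(q - 1) * r<..q * r} \<le> card ({1..r} \<times> {q})"
          using q by (simp add: card_cartesian_product algebra_simps)
        fix v assume "v \<in> {1..r} \<times> {q}"
        then obtain j where j: "v = (j, q)" "j \<in> {1..r}" by auto
        then have "s v \<noteq> None"
          using stacked_column[OF assms(2), of q j] q \<open>h q = 0\<close> by auto
        then obtain y where y: "s v = Some y" by auto
        then have "slot r c y j q"
          using arranged_slot[OF assms(1)] j by auto
        then show "\<exists>y \<in> {(q - 1) * r<..q * r}. s v = Some y"
          using y q by (auto simp: slot_def)
      qed auto
    qed
    moreover have "h q \<le> r"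
      using assms(2) by (simp add: stacked_def)
    ultimately have "slot r c x (h q) q"
      using q by (auto simp: slot_def grid_def)
    with stack q have 1: "legal r c s (Store x (h q, q)) \<and> arranged r c (s((h q, q) := Some x))"
      by auto
    from 1 have "ran (s((h q, q) := Some x)) = insert x (ran s)"
      by (simp add: empty_cells_def)
    then have "stacked r c (s((h q, q) := Some x)) (h(q := h q - 1))"
      unfolding stacked_def
      using columns[of _ _ q] h_upd_le[of q] h13 gap level behind ahead q(1)
      by (intro conjI allI impI ballI) (simp_all del: fun_upd_apply add: fun_upd_other fun_upd_same)
    with 1 show ?thesis by blast
  next
    case False
    then have x: "x \<le> 3 * r" by simp
    consider (own) "x \<le> max (h 3) 1" "s (x, 2) = None"
      | (taken) "2 \<le> x" "x = h 3" "s (x, 2) \<noteq> None"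
      | (level) "2 \<le> x" "h 3 < x" "h 1 = h 3"
      | (middle) "2 \<le> h 3" "h 3 < x" "h 1 < h 3" "s (h 3, 2) = None"
      | (close) "h 3 < x" "h 1 < h 3" "2 \<le> h 3 \<longrightarrow> s (h 3, 2) \<noteq> None"
    proof -
      have "s (x, 2) = None" if "x = 1 \<or> x < h 3"
        using ahead[OF that] not_x by blast
      moreover have "x = 1 \<or> x < h 3 \<or> 2 \<le> x \<and> x = h 3 \<or> 2 \<le> x \<and> h 3 < x"
        using assms(3) by linarith
      moreover have "h 1 = h 3 \<or> h 1 < h 3"
        using h13(1) by linarith
      ultimately show ?thesis
        using that by (metis le_max_iff_disj less_or_eq_imp_le)
    qed
    then show ?thesis
    proof cases
      case own
      have x_le: "x \<le> r"
        using own(1) h_le[of 3] r by linarith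
      have "accessible r c s (x, 2)"
      proof (cases "x = 1")
        case True
        then show ?thesis
          using assms(6) r by (intro accessible_column) (auto simp: grid_def)
      next
        case False
        then show ?thesis
          using own(1) assms(3,6) x_le corridor
          by (intro accessible_beside_column[of _ _ _ _ 3]) (auto simp: grid_def)
      qed
      with own x_le x assms have 1: "legal r c s (Store x (x, 2)) \<and> arranged r c (s((x, 2) := Some x))"
        by (intro legal_slot) (auto simp: slot_def grid_def)
      have "stacked r c (s((x, 2) := Some x)) h"
        unfolding stacked_def
        using columns_2[of _ _ x] h_le h13 gap level behind ahead ran[of "(x, 2)"] own
        by (intro conjI allI impI ballI) auto
      with 1 show ?thesis by blast
    next
      case taken
      \<comment> \<open>With level columns the place could hold only \<open>x\<close> itself, which
        is not stored yet.\<close>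
      have "h 1 \<noteq> h 3"
        using level taken not_x by metis
      moreover have "h 3 \<le> h 1 + 1"
        using gap taken assms(5) by simp
      ultimately have h: "h 3 = h 1 + 1"
        using h13 by simp
      have "slot r c x (h 1) 1"
        using h taken x h_le[of 1] assms(6) by (auto simp: slot_def grid_def)
      then have 1: "legal r c s (Store x (h 1, 1)) \<and> arranged r c (s((h 1, 1) := Some x))"
        by (rule stack) simp
      have "s (h 1, 1) = None"
        using 1 by (simp add: empty_cells_def)
      \<comment> \<open>Columns 1 and 3 are now two rows apart. The stricter bound
        \<open>h 3 \<le> h 1 + 1\<close> lapses because load \<open>h 3\<close> has just been
        stored.\<close>
      then have "stacked r c (s((h 1, 1) := Some x)) (h(1 := h 1 - 1))"
        unfolding stacked_def
        using columns[of _ _ 1] h_upd_le[of 1] h behind ahead ran(2)[of "(h 1, 1)"] taken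
        by (intro conjI allI impI ballI) (simp_all del: fun_upd_apply add: fun_upd_other fun_upd_same)
      with 1 show ?thesis by blast
    next
      case level
      have "h 3 \<noteq> 0"
      proof
        assume h3: "h 3 = 0"
        \<comment> \<open>Otherwise all cells of the first three columns except (1, 2) are filled.
          These are \<open>3 * r - 1\<close> cells, and their labels lie among the
          \<open>3 * r - 1\<close> labels from 2 on, one of which is the absent
          \<open>x\<close>.\<close>
        show False
        proof (rule arranged_pigeonhole[OF assms(1) _ _ assms(5)])
          show "x \<in> {2..3 * r}" using level x by simp
          have "card ({1..r} \<times> {1, 2, 3 :: nat} - {(1, 2)}) = card ({1..r} \<times> {1, 2, 3 :: nat}) - 1"
            using r by (intro card_Diff_singleton) auto
          then show "card {2..3 * r} \<le> card ({1..r} \<times> {1, 2, 3 :: nat} - {(1, 2)})"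
            by (simp add: card_cartesian_product)
          fix v assume "v \<in> {1..r} \<times> {1, 2, 3 :: nat} - {(1, 2)}"
          moreover obtain j q where "v = (j, q)"
            by (cases v)
          ultimately have v: "v = (j, q)" "1 \<le> j" "j \<le> r" "q = 1 \<or> q = 2 \<and> j \<noteq> 1 \<or> q = 3"
            by auto
          have "s (j, q) \<noteq> None"
            using stacked_column[OF assms(2), of q j] behind[of j] v level h3 assms(6) by auto
          then obtain y where y: "s (j, q) = Some y" by auto
          then have "slot r c y j q"
            by (rule arranged_slot[OF assms(1)])
          then show "\<exists>y \<in> {2..3 * r}. s v = Some y"
            using y v by (auto simp: slot_def)
        qed auto
      qed
      with level have "slot r c x (h 1) 1"
        using x h_le[of 1] assms(6) by (auto simp: slot_def grid_def)
      then have 1: "legal r c s (Store x (h 1, 1)) \<and> arranged r c (s((h 1, 1) := Some x))"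
        by (rule stack) simp
      have "stacked r c (s((h 1, 1) := Some x)) (h(1 := h 1 - 1))"
        unfolding stacked_def
        using columns[of _ _ 1] h_upd_le[of 1] behind ahead level \<open>h 3 \<noteq> 0\<close>
        by (intro conjI allI impI ballI) (simp_all del: fun_upd_apply add: fun_upd_other fun_upd_same)
      with 1 show ?thesis by blast
    next
      case middle
      have "accessible r c s (h 3, 2)"
        using middle assms(6) h_le[of 3] corridor
        by (intro accessible_beside_column[of _ _ _ _ 3]) (auto simp: grid_def)
      then have 1: "legal r c s (Store x (h 3, 2)) \<and> arranged r c (s((h 3, 2) := Some x))"
        using middle x assms(6) h_le[of 3]
        by (intro legal_slot) (auto simp: slot_def grid_def)
      \<comment> \<open>A foreign load at (\<open>h 3\<close>, 2) is tolerated because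
        \<open>h 1 < h 3\<close> and \<open>2 \<le> h 3\<close>.\<close>
      have "stacked r c (s((h 3, 2) := Some x)) h"
        unfolding stacked_def
        using columns_2[of _ _ "h 3"] h_le h13 gap behind ahead ran(1)[of "(h 3, 2)"] middle
        by (intro conjI allI impI ballI) auto
      with 1 show ?thesis by blast
    next
      case close
      have "slot r c x (h 3) 3"
        using close x h_le[of 3] assms(6) by (auto simp: slot_def grid_def)
      then have 1: "legal r c s (Store x (h 3, 3)) \<and> arranged r c (s((h 3, 3) := Some x))"
        by (rule stack) simp
      \<comment> \<open>Row \<open>h 3\<close> now lies behind the corridor, and its cell in column
        2 is filled by the case assumption, unless the row is 1.\<close>
      have behind': "s (j, 2) \<noteq> None" if "2 \<le> j" "j \<le> r" "h 3 - 1 < j" for j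
        using behind[OF that(1,2)] close(3) that by (cases "j = h 3") auto
      have ahead': "s (j, 2) = None \<or> s (j, 2) = Some j" if "j = 1 \<or> j < h 3 - 1" for j
        using that by (intro ahead) auto
      \<comment> \<open>The columns may become level at row \<open>h 3 - 1\<close>, where column 2
        holds at most the proper load.\<close>
      have "s (h 3 - 1, 2) = None \<or> s (h 3 - 1, 2) = Some (h 3 - 1)"
        using close(2) by (intro ahead) simp
      then have "stacked r c (s((h 3, 3) := Some x)) (h(3 := h 3 - 1))"
        unfolding stacked_def
        using columns[of _ _ 3] h_upd_le[of 3] behind' ahead' close(2) h13
        by (intro conjI allI impI ballI) (simp_all del: fun_upd_apply add: fun_upd_other fun_upd_same)
      with 1 show ?thesis by blast
    qed
  qed
qed


lemma stacked_empty: "stacked r c Map.empty (\<lambda>_. r)"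
  by (auto simp: stacked_def)

section \<open>Retrieval with at least three columns\<close>

text \<open>Load \<open>k\<close> is at its place, beside the free stretch of column 2, or in a
  column \<open>q \<ge> 4\<close> next to an empty one. If the place of \<open>k\<close> stays
  occupied, the vacated cell can receive its occupant later.\<close>

lemma arranged_retrieve:
  assumes "arranged r c s" "ran s = {k..n}" "k \<le> n" "3 \<le> c" "\<And>j. j < k \<Longrightarrow> s (j, 2) = None"
  obtains j q where "s (j, q) = Some k" "legal r c s (Retrieve k (j, q))"
    "(s((j, q) := None)) (k, 2) = None \<or> (q = 1 \<or> q = 3) \<and> 1 \<le> j \<and> j < k"
proof -
  have "k \<in> ran s"
    using assms by simp
  then obtain j q where u: "s (j, q) = Some k"
    by (auto simp: ran_def)
  have slot: "slot r c k j q"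
    using assms(1) u by (rule arranged_slot)
  then have grid: "(j, q) \<in> grid r c"
    by (simp add: slot_def)
  consider "q = 2" "j = k" | "q = 1 \<or> q = 3" "1 \<le> j" "j < k" | "4 \<le> q" "(q - 1) * r < k"
  proof (cases "q \<le> 3")
    case True
    moreover have "j < k \<Longrightarrow> q \<noteq> 2"
      using assms(5) u by auto
    moreover have "1 \<le> j" "q = 1 \<or> q = 2 \<or> q = 3"
      using grid True by (auto simp: grid_def)
    ultimately show ?thesis
      using that(1,2) slot by (auto simp: slot_def)
  next
    case False
    then show ?thesis
      using that slot by (auto simp: slot_def)
  qed
  then have "accessible r c s (j, q) \<and>
    ((s((j, q) := None)) (k, 2) = None \<or> (q = 1 \<or> q = 3) \<and> 1 \<le> j \<and> j < k)"
  proof cases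
    case 1
    then show ?thesis
      using grid assms(5) by (auto intro!: accessible_column)
  next
    case 2
    then show ?thesis
      using grid assms(4,5) by (auto simp: grid_def intro!: accessible_beside_column[of _ _ _ _ 2])
  next
    case 3
    \<comment> \<open>Column \<open>q - 1\<close> admits only labels up to
      \<open>(q - 1) * r\<close>, and these have all departed.\<close>
    have "s (i, q - 1) = None" for i
    proof (rule ccontr)
      assume "s (i, q - 1) \<noteq> None"
      then obtain y where y: "s (i, q - 1) = Some y" by auto
      then have "slot r c y i (q - 1)"
        by (rule arranged_slot[OF assms(1)])
      then have "y \<le> (q - 1) * r"
        using 3 by (cases "q = 4") (auto simp: slot_def split: if_splits)
      moreover have "k \<le> y"
        using ranI[of s, OF y] assms(2) by auto
      ultimately show False
        using 3 by simp
    qed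
    then have "accessible r c s (j, q)"
      using grid 3 by (intro accessible_beside_column[of _ _ _ _ "q - 1"]) (auto simp: grid_def)
    \<comment> \<open>Here \<open>k\<close> exceeds \<open>r\<close>, so (\<open>k\<close>, 2) lies
      outside the grid and is trivially empty.\<close>
    moreover have "1 * r \<le> (q - 1) * r"
      using 3 by (intro mult_le_mono1) simp
    then have "r < k"
      using 3(2) by (metis le_less_trans mult_1)
    then have "s (k, 2) = None"
      using arranged_slot[OF assms(1), of k 2] by (cases "s (k, 2)") (auto simp: slot_def grid_def)
    ultimately show ?thesis by simp
  qed
  then show ?thesis
    using that[OF u legal_RetrieveI[of _ r c s, OF grid u]] by blast
qed

text \<open>
  The last assumption leaves room for a pending relocation: the load at the place (\<open>k - 1\<close>, 2) moves
  into the gap left by load \<open>k - 1\<close>, as the first action charged to load \<open>k\<close>. The bound counts the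
  \<open>k' \<ge> k\<close> with \<open>3 \<le> k' \<le> r + 1\<close>.
\<close>

lemma arranged_retrieval_plan:
  assumes "Suc n - k = d" "arranged r c s" "ran s = {k..n}" "3 \<le> c"
    and "\<And>j. Suc j < k \<Longrightarrow> s (j, 2) = None"
    and "s (k - 1, 2) = None \<or> (\<exists>j q. (q = 1 \<or> q = 3) \<and> 1 \<le> j \<and> Suc j < k \<and> s (j, q) = None)"
  shows "retrieval_plan r c n k s (r + 2 - max k 3)"
  using assms
proof (induction d arbitrary: k s)
  case 0
  then show ?case by (simp add: retrieval_plan_done)
next
  case (Suc d)
  then have k: "k \<le> n" by simp
  \<comment> \<open>The retrieval common to both cases, applied once rows below \<open>k\<close> of
    column 2 are free, with or without a preceding relocation. The cell vacated by \<open>k\<close>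
    provides the gap for \<open>Suc k\<close>.\<close>
  have clear: "\<exists>u. legal r c s' (Retrieve k u) \<and>
      retrieval_plan r c n (Suc k) (s'(u := None)) (r + 2 - max (Suc k) 3)"
    if s': "arranged r c s'" "ran s' = {k..n}" "\<And>j. j < k \<Longrightarrow> s' (j, 2) = None" for s'
  proof -
    obtain j q where u: "s' (j, q) = Some k" "legal r c s' (Retrieve k (j, q))"
      "(s'((j, q) := None)) (k, 2) = None \<or> (q = 1 \<or> q = 3) \<and> 1 \<le> j \<and> j < k"
      using arranged_retrieve[OF s'(1,2) k Suc.prems(4) s'(3)] by blast
    have "ran (s'((j, q) := None)) = ran s' - {k}"
      using u(1) arranged_inj[OF s'(1) _ u(1)] by (rule ran_remove)
    also have "\<dots> = {Suc k..n}"
      unfolding s'(2) by auto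
    finally have ran': "ran (s'((j, q) := None)) = {Suc k..n}" .
    have "retrieval_plan r c n (Suc k) (s'((j, q) := None)) (r + 2 - max (Suc k) 3)"
    proof (rule Suc.IH[OF _ arranged_remove[OF s'(1)] ran' Suc.prems(4)])
      show "Suc n - Suc k = d"
        using Suc.prems(1) by simp
      show "(s'((j, q) := None)) (i, 2) = None" if "Suc i < Suc k" for i
        using s'(3) that by simp
      show "(s'((j, q) := None)) (Suc k - 1, 2) = None \<or> (\<exists>i p. (p = 1 \<or> p = 3) \<and> 1 \<le> i \<and>
          Suc i < Suc k \<and> (s'((j, q) := None)) (i, p) = None)"
        using u(3) by auto
    qed
    with u(2) show ?thesis by blast
  qed
  show ?case
  proof (cases "s (k - 1, 2)")
    case None
    then have "s (j, 2) = None" if "j < k" for j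
      using Suc.prems(5)[of j] that by (cases "Suc j = k") auto
    from clear[OF Suc.prems(2,3) this] obtain u where u: "legal r c s (Retrieve k u)"
      "retrieval_plan r c n (Suc k) (s(u := None)) (r + 2 - max (Suc k) 3)"
      by blast
    show ?thesis
      by (rule retrieval_plan_mono[OF retrieval_plan_retrieve[OF k u]]) simp
  next
    case (Some x)
    let ?u = "(k - 1, 2)"
    from Some Suc.prems(6) obtain j q where v: "q = 1 \<or> q = 3" "1 \<le> j" "Suc j < k" "s (j, q) = None"
      by auto
    let ?s = "s(?u := None, (j, q) := Some x)"
    have slot: "slot r c x (k - 1) 2"
      using Suc.prems(2) Some by (rule arranged_slot)
    then have k_le: "k - 1 \<le> r" and x: "x \<le> 3 * r" "k - 1 \<le> x"
      by (auto simp: slot_def grid_def)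
    have u_grid: "?u \<in> grid r c"
      using slot by (simp add: slot_def)
    have v_grid: "(j, q) \<in> grid r c" "(j, 2) \<in> grid r c"
      using v k_le Suc.prems(4) by (auto simp: grid_def)
    \<comment> \<open>The route runs inside the free stretch of column 2; reversed, it is extended
      by a sideways step into the gap.\<close>
    have "path_within (insert ?u (empty_cells r c s)) (j, 2) ?u"
    proof (rule path_within_column)
      show "j \<le> k - 1" using v by simp
      fix i assume i: "j \<le> i" "i \<le> k - 1"
      show "(i, 2) \<in> insert ?u (empty_cells r c s)"
        using i v k_le Suc.prems(4) Suc.prems(5)[of i] by (cases "i = k - 1") (auto simp: empty_cells_def grid_def)
    qed
    from path_within_sym[OF this] have path: "path_within (insert ?u (empty_cells r c s)) ?u (j, q)"
    proof (rule path_within_snoc)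
      show "adjacent (j, 2) (j, q)"
        using v(1) by (auto simp: adjacent_def)
      show "(j, q) \<in> insert ?u (empty_cells r c s)"
        using v(4) v_grid by (simp add: empty_cells_def)
    qed
    have acc_u: "accessible r c s ?u"
      using u_grid Suc.prems(5) by (intro accessible_column) auto
    have acc_v: "accessible r c s (j, q)"
      using v v_grid Suc.prems(5) by (intro accessible_beside_column[of _ _ _ _ 2]) auto
    have legal: "legal r c s (Relocate x ?u (j, q))"
      using u_grid Some v v_grid acc_u acc_v path by (simp add: empty_cells_def)
    have rem: "ran (s(?u := None)) = ran s - {x}"
      using Some arranged_inj[OF Suc.prems(2) _ Some] by (rule ran_remove)
    \<comment> \<open>The gap is admissible for \<open>x\<close> because
      \<open>j < k - 1 \<le> x\<close>.\<close>
    have "slot r c x j q"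
      using v v_grid x by (auto simp: slot_def)
    with arranged_remove[OF Suc.prems(2)] have arr: "arranged r c ?s"
      using rem by (intro arranged_store) auto
    have "ran ?s = insert x (ran (s(?u := None)))"
      using v(4) by (intro ran_map_upd) simp
    also have "\<dots> = {k..n}"
      unfolding rem using ranI[of s, OF Some] Suc.prems(3) by (simp add: insert_absorb)
    finally have ran: "ran ?s = {k..n}" .
    have "?s (i, 2) = None" if "i < k" for i
      using Suc.prems(5)[of i] that v by (cases "Suc i = k") auto
    from clear[OF arr ran this] obtain w where w: "legal r c ?s (Retrieve k w)"
      "retrieval_plan r c n (Suc k) (?s(w := None)) (r + 2 - max (Suc k) 3)"
      by blast
    have "retrieval_plan r c n k s (Suc (r + 2 - max (Suc k) 3))"
      by (rule retrieval_plan_relocate[OF k legal refl w])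
    \<comment> \<open>A relocation occurs only for \<open>3 \<le> k \<le> r + 1\<close>, where the
      bound drops by exactly one from \<open>k\<close> to \<open>Suc k\<close>.\<close>
    moreover have "Suc (r + 2 - max (Suc k) 3) = r + 2 - max k 3"
      using v k_le by simp
    ultimately show ?thesis by (simp only:)
  qed
qed

lemma arranged_retrieval_plan_from_1:
  assumes "3 \<le> c" "ran s = {1..n}" "arranged r c s"
  shows "retrieval_plan r c n 1 s (r - 1)"
proof -
  \<comment> \<open>For \<open>k = 1\<close> the cell (\<open>k - 1\<close>, 2) has row 0 and lies
    outside the grid.\<close>
  have "s (0, 2) = None"
    using arranged_slot[OF assms(3), of 0 2] by (cases "s (0, 2)") (auto simp: slot_def grid_def)
  then have "retrieval_plan r c n 1 s (r + 2 - max 1 3)"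
    using assms by (intro arranged_retrieval_plan[OF refl]) auto
  then show ?thesis by simp
qed

section \<open>Fewer than three columns\<close>

text \<open>Every cell is in the front row, so load \<open>x\<close> simply takes column
  \<open>x\<close>.\<close>

lemma single_row_store_step:
  assumes "\<And>v y. s v = Some y \<Longrightarrow> v = (1, y) \<and> 1 \<le> y \<and> y \<le> c" "1 \<le> x" "x \<le> c" "x \<notin> ran s"
  shows "legal 1 c s (Store x (1, x))"
proof (rule legal_StoreI[OF assms(4)])
  show "(1, x) \<in> grid 1 c"
    using assms by (auto simp: grid_def)
  show "s (1, x) = None"
    using assms(1)[of "(1, x)"] ranI[of s "(1, x)"] assms(4) by (cases "s (1, x)") auto
  show "accessible 1 c s (1, x)"
    using assms by (intro accessible_column) (auto simp: grid_def)
qed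

lemma single_row_retrieval_plan:
  assumes "\<And>v y. s v = Some y \<Longrightarrow> v = (1, y) \<and> 1 \<le> y \<and> y \<le> c" "ran s = {1..n}"
  shows "retrieval_plan 1 c n 1 s 0"
proof (rule retrieval_plan_direct[OF refl assms(2)])
  let ?P = "\<lambda>s :: config. \<forall>v y. s v = Some y \<longrightarrow> v = (1, y) \<and> 1 \<le> y \<and> y \<le> c"
  show "?P s" using assms(1) by blast
  show "u = v" if "?P s" "s u = Some x" "s v = Some x" for s u v x
    using that by blast
  show "legal 1 c s (Retrieve x u) \<and> ?P (s(u := None))" if "?P s" "s u = Some x" for s u x
  proof
    have u: "u = (1, x)" "1 \<le> x" "x \<le> c"
      using that by blast+
    then have "u \<in> grid 1 c"
      by (auto simp: grid_def)
    moreover from this have "accessible 1 c s u"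
      unfolding u(1) by (intro accessible_column) auto
    ultimately show "legal 1 c s (Retrieve x u)"
      using that(2) by (intro legal_RetrieveI)
    show "?P (s(u := None))"
      using that(1) by (metis fun_upd_apply option.distinct(1))
  qed
qed

section \<open>The 2 x 2 area\<close>

text \<open>The corner (1, 1) is reserved for load 1. The others fill (2, 1), (2, 2), (1, 2) in this
  order, entering through column 2, so no cell is blocked before its turn.\<close>

definition arranged_2x2 :: "config \<Rightarrow> bool" where
  "arranged_2x2 s \<longleftrightarrow>
    (\<forall>v x. s v = Some x \<longrightarrow> v \<in> grid 2 2 \<and> x \<in> {1..4} \<and> (v = (1, 1) \<longleftrightarrow> x = 1)) \<and>
    (\<forall>u v x. s u = Some x \<longrightarrow> s v = Some x \<longrightarrow> u = v) \<and>
    (s (2, 1) = None \<longrightarrow> s (2, 2) = None) \<and> (s (2, 2) = None \<longrightarrow> s (1, 2) = None)"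

lemma grid_2x2: "grid 2 2 = {(1, 1), (1, 2), (2, 1), (2, 2)}"
  by (auto simp: grid_def)

lemma arranged_2x2_store_step:
  assumes "arranged_2x2 s" "x \<in> {1..4}" "x \<notin> ran s"
  shows "\<exists>v. legal 2 2 s (Store x v) \<and> arranged_2x2 (s(v := Some x))"
proof -
  have not_x: "s v \<noteq> Some x" for v
    using assms(3) by (auto dest: ranI)
  have s: "s v = Some y \<Longrightarrow> v \<in> grid 2 2 \<and> y \<in> {1..4} \<and> (v = (1, 1) \<longleftrightarrow> y = 1)"
    and inj: "s u = Some y \<Longrightarrow> s v = Some y \<Longrightarrow> u = v"
    and order: "s (2, 1) = None \<longrightarrow> s (2, 2) = None" "s (2, 2) = None \<longrightarrow> s (1, 2) = None" for u v y
    using assms(1) unfolding arranged_2x2_def by blast+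
  have store: "legal 2 2 s (Store x v) \<and> arranged_2x2 (s(v := Some x))"
    if "s v = None" "accessible 2 2 s v" "v \<in> grid 2 2" "v = (1, 1) \<longleftrightarrow> x = 1"
      "v = (2, 2) \<longrightarrow> s (2, 1) \<noteq> None" "v = (1, 2) \<longrightarrow> s (2, 2) \<noteq> None" for v
  proof
    show "legal 2 2 s (Store x v)"
      using that assms(3) by (intro legal_StoreI)
    have "u \<in> grid 2 2 \<and> y \<in> {1..4} \<and> (u = (1, 1) \<longleftrightarrow> y = 1)" if "(s(v := Some x)) u = Some y" for u y
      using that s[of u y] \<open>v \<in> grid 2 2\<close> \<open>v = (1, 1) \<longleftrightarrow> x = 1\<close> assms(2)
      by (metis fun_upd_apply option.inject)
    moreover have "u = w" if "(s(v := Some x)) u = Some y" "(s(v := Some x)) w = Some y" for u w y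
      using that not_x inj by (metis fun_upd_apply option.inject)
    moreover have "(s(v := Some x)) (2, 1) = None \<longrightarrow> (s(v := Some x)) (2, 2) = None"
      "(s(v := Some x)) (2, 2) = None \<longrightarrow> (s(v := Some x)) (1, 2) = None"
      using that(5,6) order by auto
    ultimately show "arranged_2x2 (s(v := Some x))"
      unfolding arranged_2x2_def by blast
  qed
  show ?thesis
  proof (cases "x = 1")
    case True
    have "s (1, 1) = None"
      using s[of "(1, 1)"] not_x[of "(1, 1)"] True by (cases "s (1, 1)") auto
    moreover have "accessible 2 2 s (1, 1)"
      by (rule accessible_column) (auto simp: grid_2x2)
    ultimately show ?thesis
      using True by (intro exI[of _ "(1, 1)"] store) (auto simp: grid_2x2)
  next
    case False
    consider (bl) "s (2, 1) = None" | (br) "s (2, 2) = None" "s (2, 1) \<noteq> None"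
      | (fr) "s (1, 2) = None" "s (2, 2) \<noteq> None" | (full) "s (1, 2) \<noteq> None" "s (2, 1) \<noteq> None" "s (2, 2) \<noteq> None"
      using order by blast
    then show ?thesis
    proof cases
      case bl
      have "s (i, 2) = None" if "1 \<le> i" "i \<le> 2" for i
        using order bl that by (cases "i = 1") (auto simp: le_Suc_eq numeral_2_eq_2)
      then have "accessible 2 2 s (2, 1)"
        by (intro accessible_beside_column[of _ _ _ _ 2]) (auto simp: grid_2x2)
      then show ?thesis
        using bl False by (intro exI[of _ "(2, 1)"] store) (auto simp: grid_2x2)
    next
      case br
      have "s (i, 2) = None" if "1 \<le> i" "i < 2" for i
      proof -
        have "i = 1" using that by simp
        then show ?thesis using order br by simp
      qed
      then have "accessible 2 2 s (2, 2)"
        by (intro accessible_column) (auto simp: grid_2x2)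
      then show ?thesis
        using br False by (intro exI[of _ "(2, 2)"] store) (auto simp: grid_2x2)
    next
      case fr
      have "accessible 2 2 s (1, 2)"
        by (rule accessible_column) (auto simp: grid_2x2)
      then show ?thesis
        using fr False by (intro exI[of _ "(1, 2)"] store) (auto simp: grid_2x2)
    next
      case full
      then obtain a b d where abd: "s (1, 2) = Some a" "s (2, 1) = Some b" "s (2, 2) = Some d"
        by auto
      \<comment> \<open>Three distinct labels other than 1 and \<open>x\<close> cannot be found
        among four.\<close>
      then have "{a, b, d} \<subseteq> {1..4} - {1, x}"
        using s[OF abd(1)] s[OF abd(2)] s[OF abd(3)] not_x by auto
      moreover have "a \<noteq> b" "a \<noteq> d" "b \<noteq> d"
        using inj[of "(1, 2)" a "(2, 1)"] inj[of "(1, 2)" a "(2, 2)"] inj[of "(2, 1)" b "(2, 2)"] abd by auto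
      ultimately have "card {a, b, d} \<le> card ({1..4} - {1, x})"
        by (intro card_mono) auto
      moreover have "card ({1..4} - {1, x}) = 2"
        using False assms(2) by (subst card_Diff_subset) auto
      moreover have "card {a, b, d} = 3"
        using \<open>a \<noteq> b\<close> \<open>a \<noteq> d\<close> \<open>b \<noteq> d\<close> by simp
      ultimately show ?thesis by simp
    qed
  qed
qed

text \<open>Both alternatives keep every load accessible and persist under removal. In the second
  one, a load at (2, 2) is reached through (1, 2) or through (1, 1) and (2, 1).\<close>

definition uncluttered_2x2 :: "config \<Rightarrow> bool" where
  "uncluttered_2x2 s \<longleftrightarrow>
    (\<forall>v x. s v = Some x \<longrightarrow> v \<in> grid 2 2) \<and> (\<forall>u v x. s u = Some x \<longrightarrow> s v = Some x \<longrightarrow> u = v) \<and>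
    ((\<forall>j. s (j, 2) = None) \<or> s (1, 1) = None \<and> (s (1, 2) = None \<or> s (2, 1) = None \<or> s (2, 2) = None))"

lemma uncluttered_2x2_retrieval_plan:
  assumes "uncluttered_2x2 s" "ran s = {k..n}"
  shows "retrieval_plan 2 2 n k s 0"
proof (rule retrieval_plan_direct[where P = uncluttered_2x2, OF refl assms(2,1)])
  show "u = v" if "uncluttered_2x2 s" "s u = Some x" "s v = Some x" for s u v x
    using that unfolding uncluttered_2x2_def by blast
  show "legal 2 2 s (Retrieve x u) \<and> uncluttered_2x2 (s(u := None))"
    if s: "uncluttered_2x2 s" and u: "s u = Some x" for s u x
  proof
    have grid: "u \<in> grid 2 2"
      using s u unfolding uncluttered_2x2_def by blast
    have row: "i = 1" if "1 \<le> i" "i < 2" for i :: nat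
      using that by simp
    have rows: "i = 1 \<or> i = 2" if "1 \<le> i" "i \<le> 2" for i :: nat
      using that by auto
    have "accessible 2 2 s u"
    proof (cases "\<forall>j. s (j, 2) = None")
      case True
      then have "u \<in> {(1, 1), (2, 1)}"
        using u grid by (auto simp: grid_2x2)
      then show ?thesis
        using True by (auto intro!: accessible_beside_column[of _ _ _ _ 2] simp: grid_2x2)
    next
      case False
      then have free: "s (1, 1) = None" "s (1, 2) = None \<or> s (2, 1) = None \<or> s (2, 2) = None"
        using s by (auto simp: uncluttered_2x2_def)
      consider "u = (1, 2)" | "u = (2, 1)" | "u = (2, 2)" "s (1, 2) = None" | "u = (2, 2)" "s (2, 1) = None"
        using grid u free by (auto simp: grid_2x2)
      then show ?thesis
      proof cases
        case 4
        then show ?thesis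
          using free(1) by (auto intro!: accessible_beside_column[of _ _ _ _ 1] simp: grid_2x2 dest!: rows)
      qed (use free(1) in \<open>auto intro!: accessible_column simp: grid_2x2 dest!: row\<close>)
    qed
    then show "legal 2 2 s (Retrieve x u)"
      using grid u by (intro legal_RetrieveI)
    have "s v = Some y" if "(s(u := None)) v = Some y" for v y
      using that by (simp split: if_splits)
    moreover have "(s(u := None)) v = None" if "s v = None" for v
      using that by simp
    ultimately show "uncluttered_2x2 (s(u := None))"
      using s unfolding uncluttered_2x2_def by meson
  qed
qed

text \<open>After load 1 has left, the only obstruction is load 2 at (2, 2) with (1, 2) and (2, 1)
  occupied. Moving the load at (1, 2) to (1, 1) frees load 2, whose departure empties column
  2.\<close>

lemma arranged_2x2_retrieval_plan:
  assumes "arranged_2x2 s" "ran s = {1..n}"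
  shows "retrieval_plan 2 2 n 1 s 1"
proof (cases "n = 0")
  case True
  then show ?thesis by (simp add: retrieval_plan_done)
next
  case False
  have s: "s v = Some y \<Longrightarrow> v \<in> grid 2 2 \<and> (v = (1, 1) \<longleftrightarrow> y = 1)"
    and inj: "s u = Some y \<Longrightarrow> s v = Some y \<Longrightarrow> u = v" for u v y
    using assms(1) unfolding arranged_2x2_def by blast+
  have "1 \<in> ran s"
    using assms(2) False by simp
  then have s1: "s (1, 1) = Some 1"
    using s by (auto simp: ran_def)
  define t where "t = s((1, 1) := None)"
  then have t11: "t (1, 1) = None"
    by simp
  have t: "v \<in> grid 2 2" if "t v = Some y" for v y
    using that s by (auto simp: t_def split: if_splits)
  have t_inj: "u = v" if "t u = Some y" "t v = Some y" for u v y
    using that inj by (metis t_def fun_upd_apply option.distinct(1))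
  have "ran t = ran s - {1}"
    unfolding t_def using s1 inj[OF _ s1] by (rule ran_remove)
  also have "\<dots> = {2..n}"
    unfolding assms(2) by auto
  finally have ran_t: "ran t = {2..n}" .
  have "legal 2 2 s (Retrieve 1 (1, 1))"
    using s1 by (intro legal_RetrieveI accessible_column) (auto simp: grid_2x2)
  then have start: "retrieval_plan 2 2 n 1 s 1" if "retrieval_plan 2 2 n 2 t 1"
    using that False retrieval_plan_retrieve[of 1 n 2 2 s "(1, 1)" 1]
    by (simp add: t_def Suc_1 del: legal.simps One_nat_def)
  \<comment> \<open>Once load 2 leaves an uncluttered area, the rest needs no relocation.\<close>
  have finish: "retrieval_plan 2 2 n (Suc 2) (t'(u := None)) 0"
    if t': "t' u = Some 2" "ran t' = {2..n}" "uncluttered_2x2 (t'(u := None))"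
      "\<And>v. t' v = Some 2 \<Longrightarrow> v = u" for t' u
  proof (rule uncluttered_2x2_retrieval_plan[OF t'(3)])
    have "ran (t'(u := None)) = ran t' - {2}"
      using t'(1,4) by (rule ran_remove)
    also have "\<dots> = {Suc 2..n}"
      unfolding t'(2) by auto
    finally show "ran (t'(u := None)) = {Suc 2..n}" .
  qed
  show ?thesis
  proof (rule start, cases "t (1, 2) = None \<or> t (2, 1) = None \<or> t (2, 2) = None")
    case True
    then have "uncluttered_2x2 t"
      using t t_inj t11 unfolding uncluttered_2x2_def by blast
    then show "retrieval_plan 2 2 n 2 t 1"
      using retrieval_plan_mono[OF uncluttered_2x2_retrieval_plan[OF _ ran_t]] by simp
  next
    case full: False
    then obtain w where w: "t (1, 2) = Some w"
      by auto
    then have n: "2 \<le> n"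
      using ranI[of t, OF w] ran_t by auto
    then have "2 \<in> ran t"
      using ran_t by simp
    then obtain u where u: "t u = Some 2"
      by (auto simp: ran_def)
    have uniq: "v = u" if "t v = Some 2" for v
      using t_inj that u by blast
    have row: "i = 1" if "1 \<le> i" "i < 2" for i :: nat
      using that by simp
    show "retrieval_plan 2 2 n 2 t 1"
    proof (cases "u = (2, 2)")
      case False
      then have u_cases: "u = (1, 2) \<or> u = (2, 1)"
        using t[OF u] u t11 by (auto simp: grid_2x2)
      then have "accessible 2 2 t u"
        using t11 by (auto intro!: accessible_column simp: grid_2x2 dest!: row)
      with t[OF u] u have "legal 2 2 t (Retrieve 2 u)"
        by (rule legal_RetrieveI)
      moreover have "uncluttered_2x2 (t(u := None))"
      proof -
        have "t v = Some y" if "(t(u := None)) v = Some y" for v y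
          using that by (simp split: if_splits)
        moreover have "(t(u := None)) (1, 1) = None"
          "(t(u := None)) (1, 2) = None \<or> (t(u := None)) (2, 1) = None"
          using t11 u_cases by auto
        ultimately show ?thesis
          using t t_inj unfolding uncluttered_2x2_def by meson
      qed
      ultimately show ?thesis
        using finish[OF u ran_t _ uniq] n
        by (intro retrieval_plan_mono[OF retrieval_plan_retrieve, of 2 n 2 2 t u 0 1]) auto
    next
      case True
      let ?t = "t((1, 2) := None, (1, 1) := Some w)"
      have acc: "accessible 2 2 t (1, 1)" "accessible 2 2 t (1, 2)"
        by (rule accessible_column; auto simp: grid_2x2)+
      have "path_within (insert (1, 2) (empty_cells 2 2 t)) (1, 2) (1, 1)"
        using t11 by (intro path_within_snoc[OF path_within_refl])
          (auto simp: adjacent_def empty_cells_def grid_2x2)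
      with acc w t11 have relocate: "legal 2 2 t (Relocate w (1, 2) (1, 1))"
        by (simp add: empty_cells_def grid_2x2)
      have w2: "w \<noteq> 2"
        using uniq[of "(1, 2)"] w True by auto
      have u': "?t (2, 2) = Some 2"
        using u True by simp
      have retrieve: "legal 2 2 ?t (Retrieve 2 (2, 2))"
        using u' by (intro legal_RetrieveI accessible_column) (auto simp: grid_2x2 dest!: row)
      have rem: "ran (t((1, 2) := None)) = ran t - {w}"
        using w t_inj[OF _ w] by (rule ran_remove)
      have "ran ?t = insert w (ran (t((1, 2) := None)))"
        using t11 by (intro ran_map_upd) simp
      then have ran': "ran ?t = {2..n}"
        unfolding rem using ranI[of t, OF w] ran_t by (simp add: insert_absorb)
      have uniq': "v = (2, 2)" if "?t v = Some 2" for v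
        using that uniq True w2 by (auto split: if_splits)
      have "uncluttered_2x2 (?t((2, 2) := None))"
        unfolding uncluttered_2x2_def
      proof (intro conjI allI impI disjI1)
        have moved: "v = (1, 1) \<and> y = w \<or> v \<notin> {(1, 2), (2, 2)} \<and> t v = Some y"
          if "(?t((2, 2) := None)) v = Some y" for v y
          using that by (auto split: if_splits)
        show "v \<in> grid 2 2" if "(?t((2, 2) := None)) v = Some y" for v y
          using moved[OF that] t[of v y] by (auto simp: grid_2x2)
        show "v = v'" if "(?t((2, 2) := None)) v = Some y" "(?t((2, 2) := None)) v' = Some y" for v v' y
          using moved[OF that(1)] moved[OF that(2)] t_inj w by (metis insertCI)
        show "(?t((2, 2) := None)) (j, 2) = None" for j
          using t[of "(j, 2)"] by (cases "t (j, 2)") (auto simp: grid_2x2)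
      qed
      from finish[OF u' ran' this uniq'] have "retrieval_plan 2 2 n 2 t (Suc 0)"
        by (rule retrieval_plan_relocate[OF n relocate refl retrieve])
      then show ?thesis by simp
    qed
  qed
qed

section \<open>Assembly over all sizes of the area\<close>

theorem theorem4:
  fixes r c n :: nat
  assumes "1 \<le> r" and "r \<le> c" and "n \<le> r * c"
  shows "\<exists>\<sigma> :: policy. \<forall>A. arrival_sequence n A \<longrightarrow>
    (\<exists>Rs. valid_plan r c n A (online_storage 1 \<sigma> A) Rs \<and>
          (\<forall>b \<in> set (online_storage 1 \<sigma> A). length b = 1) \<and>
          (\<forall>b \<in> set Rs. length b \<le> 2) \<and>
          num_relocations (concat (online_storage 1 \<sigma> A) @ concat Rs) \<le> r - 1)"
proof (cases "3 \<le> c")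
  case True
  let ?I = "\<lambda>s. arranged r c s \<and> (\<exists>h. stacked r c s h)"
  show ?thesis
  proof (rule invariant_policy_correct[of ?I])
    show "?I Map.empty"
      using stacked_empty by (auto simp: arranged_def)
    show "\<exists>v. legal r c s (Store x v) \<and> ?I (s(v := Some x))"
      if "?I s" "x \<in> {1..n}" "x \<notin> ran s" for s x
    proof -
      from that(1) obtain h where "arranged r c s" "stacked r c s h" by blast
      from arranged_store_step[OF this, of x] that(2,3) True assms(3) show ?thesis by simp
    qed
    show "retrieval_plan r c n 1 s (r - 1)" if "?I s" "ran s = {1..n}" for s
      using arranged_retrieval_plan_from_1[OF True that(2)] that(1) by blast
  qed
next
  case False
  show ?thesis
  proof (cases "r = 1")
    case True
    let ?I = "\<lambda>s :: config. \<forall>v y. s v = Some y \<longrightarrow> v = (1, y) \<and> 1 \<le> y \<and> y \<le> c"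
    show ?thesis
      unfolding True
    proof (rule invariant_policy_correct[of ?I])
      show "?I Map.empty" by simp
      show "\<exists>v. legal 1 c s (Store x v) \<and> ?I (s(v := Some x))"
        if "?I s" "x \<in> {1..n}" "x \<notin> ran s" for s x
      proof (intro exI conjI)
        have x: "1 \<le> x" "x \<le> c"
          using that(2) assms(3) True by auto
        show "legal 1 c s (Store x (1, x))"
          using that(1,3) x by (intro single_row_store_step) blast+
        show "?I (s((1, x) := Some x))"
          using that(1) x by (metis fun_upd_apply option.inject)
      qed
      show "retrieval_plan 1 c n 1 s (1 - 1)" if "?I s" "ran s = {1..n}" for s
        unfolding diff_self_eq_0 using that by (intro single_row_retrieval_plan) blast+
    qed
  next
    case r: False
    then have rc: "r = 2" "c = 2"
      using False assms by auto
    show ?thesis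
      unfolding rc
    proof (rule invariant_policy_correct[of arranged_2x2])
      show "arranged_2x2 Map.empty"
        by (simp add: arranged_2x2_def)
      show "\<exists>v. legal 2 2 s (Store x v) \<and> arranged_2x2 (s(v := Some x))"
        if "arranged_2x2 s" "x \<in> {1..n}" "x \<notin> ran s" for s x
        using that assms(3) rc by (intro arranged_2x2_store_step) auto
      show "retrieval_plan 2 2 n 1 s (2 - 1)" if "arranged_2x2 s" "ran s = {1..n}" for s
        using arranged_2x2_retrieval_plan[OF that] by simp
    qed
  qed
qed

end
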